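(* Let $\eta_1,\eta_2,\eta_3>0$, $\sigma_1,\sigma_2\in\mathbb R$, let $\mathbf X^0\in\mathbb V^h$ be given, and let $(\mathbf X^m,\mu^m)\in\mathbb V^h\times\mathbb W^h$ be a solution of the following scheme: for each $m\ge0$, given $\mathbf X^m$, $(\mathbf X^{m+1},\mu^{m+1})\in\mathbb V^h\times\mathbb W^h$ satisfies $$\sum_{j=1}^3\left[\left(\frac{\mathbf X_j^{m+1}-\mathbf X_j^m}{\Delta t_m}\cdot\mathbf n_j^{m+\frac12},\varphi_j^h\right)^h_{\Gamma_j^m}+\left(\partial_{s_j}\mu_j^{m+1},\partial_{s_j}\varphi_j^h\right)^h_{\Gamma_j^m}\right]=0\qquad\forall\,\varphi^h=(\varphi^h_1,\varphi^h_2,\varphi^h_3)\in\mathbb W^h,$$ $$\begin{aligned}&\sum_{j=1}^3\left[\left(\mu_j^{m+1}\mathbf n_j^{m+\frac12},\boldsymbol\omega_j^h\right)^h_{\Gamma_j^m}-\left(\mathbf Z_{K,j}(\mathbf n_j^m)\partial_{s_j}\mathbf X_j^{m+1},\partial_{s_j}\boldsymbol\omega_j^h\right)^h_{\Gamma_j^m}\right]-\left[\frac1{\eta_1}\frac{x_A^{m+1}-x_A^m}{\Delta t_m}+\sigma_1\right]\omega^h_{1,1}(0)\\&\quad-\left[\frac1{\eta_2}\frac{x_B^{m+1}-x_B^m}{\Delta t_m}-\sigma_2\right]\omega^h_{2,1}(0)-\left[\frac1{\eta_3}\frac{x_C^{m+1}-x_C^m}{\Delta t_m}+\sigma_2-\sigma_1\right]\omega^h_{3,1}(0)=0\qquad\forall\,\boldsymbol\omega^h=(\boldsymbol\omega^h_1,\boldsymbol\omega^h_2,\boldsymbol\omega^h_3)\in\mathbb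 V^h.\end{aligned}$$ Then the total discrete area $$A^m=\frac12\sum_{k=1}^{N_2}(x_{2,k}^m-x_{2,k-1}^m)(y_{2,k}^m+y_{2,k-1}^m)-\frac12\sum_{k=1}^{N_1}(x_{1,k}^m-x_{1,k-1}^m)(y_{1,k}^m+y_{1,k-1}^m)$$ is conserved: $A^m\equiv A^0$ for all $m\ge0$.
   Context: Notation. $\mathbb S^1$ is the unit circle in $\mathbb R^2$, $(a,b)^\perp=(b,-a)$, $\mathbb I_j=[0,1]$ for $j=1,2,3$. Time levels $0=t_0<t_1<\dots$ have steps $\Delta t_m=t_{m+1}-t_m>0$. Each $\mathbb I_j$ is divided into $N_j$ subintervals $\mathbb I_{j,k}=[\rho_{j,k-1},\rho_{j,k}]$ with $\rho_{j,k}=k/N_j$. Surface energy. $\gamma_j\in C^2(\mathbb S^1)$, $\gamma_j>0$; $\widehat\gamma_j(\mathbf p)=|\mathbf p|\gamma_j(\mathbf p/|\mathbf p|)$ for $\mathbf p\ne\mathbf0$; $\boldsymbol\xi_j(\mathbf n)=\nabla\widehat\gamma_j(\mathbf p)|_{\mathbf p=\mathbf n}$. With a given function $K_j:\mathbb S^1\to[0,\infty)$ and $\mathbf I_2$ the $2\times2$ identity, $\mathbf Z_{K,j}(\mathbf n)=\gamma_j(\mathbf n)\mathbf I_2-\mathbf n\boldsymbol\xi_j(\mathbf n)^\top-\boldsymbol\xi_j(\mathbf n)\mathbf n^\top+K_j(\mathbf n)\mathbf n\mathbf n^\top$. Spaces. $\mathbb K^h(\mathbb I_j)$ is the space of continuous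 functions on $\mathbb I_j$ that are affine on each $\mathbb I_{j,k}$. $\mathbb V^h$ is the set of $(\mathbf v_1,\mathbf v_2,\mathbf v_3)\in\prod_{j=1}^3\mathbb K^h(\mathbb I_j)^2$, $\mathbf v_j=(v_{j,1},v_{j,2})$, with $v_{j,2}(0)=0$ for $j=1,2,3$ and $\mathbf v_1(1)=\mathbf v_2(1)=\mathbf v_3(1)$. $\mathbb W^h$ is the set of $(\chi_1,\chi_2,\chi_3)\in\prod_{j=1}^3\mathbb K^h(\mathbb I_j)$ with $\sum_{j=1}^3\chi_j(1)=0$. Components: $\boldsymbol\omega^h_j=(\omega^h_{j,1},\omega^h_{j,2})$. Discrete curves. $\mathbf X^m=(\mathbf X_1^m,\mathbf X_2^m,\mathbf X_3^m)$, $\mathbf X^m_j=(x^m_j,y^m_j)$, $\Gamma_j^m=\mathbf X_j^m(\mathbb I_j)$ is a polygonal curve, $x^m_{j,k}=x_j^m(\rho_{j,k})$, $y^m_{j,k}=y_j^m(\rho_{j,k})$, $\mu^m=(\mu^m_1,\mu^m_2,\mu^m_3)$. Segments: $\mathbf h^m_{j,k}=\mathbf X^m_j(\rho_{j,k})-\mathbf X^m_j(\rho_{j,k-1})$, all assumed nonzero. On $\mathbb I_{j,k}$ the unit normal is $\mathbf n_j^m=\mathbf n^m_{j,k}=-(\mathbf h^m_{j,k})^\perp/|\mathbf h^m_{j,k}|$. In the scheme at step $m$, $\partial_{s_j}f=\partial_{\rho_j}f/|\partial_{\rho_j}\mathbf X^m_j|$ (arc length of $\Gamma_j^m$), and $$\mathbf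 n_j^{m+\frac12}=-\frac{\big[\partial_{\rho_j}\mathbf X_j^m+\partial_{\rho_j}\mathbf X_j^{m+1}\big]^\perp}{2|\partial_{\rho_j}\mathbf X_j^m|}.$$ Contact points: $x_A^m=x_1^m(0)$, $x_B^m=x_2^m(0)$, $x_C^m=x_3^m(0)$. The mass-lumped inner product for (scalar or vector) functions possibly discontinuous at the nodes is $$(\mathbf u,\mathbf v)^h_{\Gamma_j^m}=\frac12\sum_{k=1}^{N_j}|\mathbf h^m_{j,k}|\big[(\mathbf u\cdot\mathbf v)(\rho_{j,k}^-)+(\mathbf u\cdot\mathbf v)(\rho_{j,k-1}^+)\big],$$ with $\pm$ denoting one-sided limits. *)

theory Defs
  imports "HOL-Analysis.Analysis"
begin

text \<open>The three curves are indexed by the type \<^typ>\<open>3\<close>. Functions on the reference interval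
  \<open>[0,1]\<close> are total functions on \<^typ>\<open>real\<close>; every notion below depends only on their values
  in \<open>[0,1]\<close>.\<close>

definition perp :: "real^2 \<Rightarrow> real^2" where
  "perp v = vector [v$2, - v$1]"

definition outer :: "real^2 \<Rightarrow> real^2 \<Rightarrow> real^2^2" where
  "outer a b = (\<chi> i j. a$i * b$j)"

definition C2_on_circle :: "(real^2 \<Rightarrow> real) \<Rightarrow> bool" where
  "C2_on_circle g \<longleftrightarrow> (\<exists>g' g''.
     (\<forall>\<theta>. ((\<lambda>t. g (vector [cos t, sin t])) has_real_derivative g' \<theta>) (at \<theta>)) \<and>
     (\<forall>\<theta>. (g' has_real_derivative g'' \<theta>) (at \<theta>)) \<and>
     continuous_on UNIV g'')"

text \<open>Here \<open>p\<close> is nonzero; at the origin the formula gives \<open>0\<close>, which is never used.\<close>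

definition gamma_hat :: "(real^2 \<Rightarrow> real) \<Rightarrow> real^2 \<Rightarrow> real" where
  "gamma_hat \<gamma> p = norm p * \<gamma> (p /\<^sub>R norm p)"

definition xi :: "(real^2 \<Rightarrow> real) \<Rightarrow> real^2 \<Rightarrow> real^2" where
  "xi \<gamma> n = (THE D. GDERIV (gamma_hat \<gamma>) n :> D)"

definition Z_mat :: "(real^2 \<Rightarrow> real) \<Rightarrow> (real^2 \<Rightarrow> real) \<Rightarrow> real^2 \<Rightarrow> real^2^2" where
  "Z_mat \<gamma> K n = \<gamma> n *\<^sub>R mat 1 - outer n (xi \<gamma> n) - outer (xi \<gamma> n) n + K n *\<^sub>R outer n n"

definition node :: "nat \<Rightarrow> nat \<Rightarrow> real" where
  "node N k = real k / real N"

definition Kh :: "nat \<Rightarrow> (real \<Rightarrow> 'a::real_normed_vector) set" where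
  "Kh N = {f. continuous_on {0..1} f \<and>
     (\<forall>k\<in>{1..N}. \<exists>a b. \<forall>\<rho>\<in>{node N (k - 1)..node N k}. f \<rho> = a + \<rho> *\<^sub>R b)}"

text \<open>Affinity of a vector-valued function is componentwise affinity, so
  \<open>Kh N\<close> at type \<^typ>\<open>real \<Rightarrow> real^2\<close> is the square of the scalar space.\<close>

definition Vh :: "(3 \<Rightarrow> nat) \<Rightarrow> (3 \<Rightarrow> real \<Rightarrow> real^2) set" where
  "Vh N = {v. (\<forall>j. v j \<in> Kh (N j)) \<and> (\<forall>j. v j 0 $ 2 = 0) \<and> v 1 1 = v 2 1 \<and> v 2 1 = v 3 1}"

definition Wh :: "(3 \<Rightarrow> nat) \<Rightarrow> (3 \<Rightarrow> real \<Rightarrow> real) set" where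
  "Wh N = {\<psi>. (\<forall>j. \<psi> j \<in> Kh (N j)) \<and> (\<Sum>j\<in>UNIV. \<psi> j 1) = 0}"

definition segment :: "nat \<Rightarrow> (real \<Rightarrow> real^2) \<Rightarrow> nat \<Rightarrow> real^2" where
  "segment N Y k = Y (node N k) - Y (node N (k - 1))"

text \<open>The piecewise constant unit normal. The index \<open>\<lceil>N \<rho>\<rceil>\<close> is the \<open>k\<close> with
  \<open>\<rho>\<^bsub>k-1\<^esub> < \<rho> \<le> \<rho>\<^bsub>k\<^esub>\<close>; the choice at the nodes is immaterial, since the lumped
  product below only sees one-sided limits. The same holds for the derivatives
  \<^term>\<open>vector_derivative Y (at \<rho>)\<close>, which exist off the nodes.\<close>

definition unit_normal :: "nat \<Rightarrow> (real \<Rightarrow> real^2) \<Rightarrow> real \<Rightarrow> real^2" where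
  "unit_normal N Y \<rho> =
     (let h = segment N Y (nat \<lceil>real N * \<rho>\<rceil>) in - (perp h /\<^sub>R norm h))"

definition half_normal :: "(real \<Rightarrow> real^2) \<Rightarrow> (real \<Rightarrow> real^2) \<Rightarrow> real \<Rightarrow> real^2" where
  "half_normal Y Y' \<rho> =
     - (perp (vector_derivative Y (at \<rho>) + vector_derivative Y' (at \<rho>))
         /\<^sub>R (2 * norm (vector_derivative Y (at \<rho>))))"

definition arc_deriv :: "(real \<Rightarrow> real^2) \<Rightarrow> (real \<Rightarrow> 'a::real_normed_vector) \<Rightarrow> real \<Rightarrow> 'a" where
  "arc_deriv Y f \<rho> = vector_derivative f (at \<rho>) /\<^sub>R norm (vector_derivative Y (at \<rho>))"

definition lumped ::
  "nat \<Rightarrow> (real \<Rightarrow> real^2) \<Rightarrow> (real \<Rightarrow> 'a::real_inner) \<Rightarrow> (real \<Rightarrow> 'a) \<Rightarrow> real" where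
  "lumped N Y u v = 1/2 * (\<Sum>k=1..N. norm (segment N Y k) *
     (Lim (at_left (node N k)) (\<lambda>\<rho>. u \<rho> \<bullet> v \<rho>) +
      Lim (at_right (node N (k - 1))) (\<lambda>\<rho>. u \<rho> \<bullet> v \<rho>)))"

definition area_below :: "nat \<Rightarrow> (real \<Rightarrow> real^2) \<Rightarrow> real" where
  "area_below N Y = 1/2 * (\<Sum>k=1..N.
     (Y (node N k) $ 1 - Y (node N (k - 1)) $ 1) * (Y (node N k) $ 2 + Y (node N (k - 1)) $ 2))"

definition total_area :: "(3 \<Rightarrow> nat) \<Rightarrow> (3 \<Rightarrow> real \<Rightarrow> real^2) \<Rightarrow> real" where
  "total_area N X = area_below (N 2) (X 2) - area_below (N 1) (X 1)"

end

theory Submission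
  imports Defs
begin

text \<open>Testing the first equation with the constants \<open>\<phi> = (-1, 1, 0)\<close>, which sum to zero at the
  junction, removes the \<open>\<mu>\<close> terms. Since \<open>n\<^bsup>m+1/2\<^esup>\<close> averages the two sets of edge vectors, the lumped
  product of the displacement with it is the exact difference of the areas below the two polygons,
  up to the telescoping boundary term \<open>(x' - x) (y' + y) / 2\<close>. That term vanishes at the contact
  points, where \<open>y = y' = 0\<close>, and cancels between curves 1 and 2 at the junction.\<close>

lemma node_less: "1 \<le> N \<Longrightarrow> k \<in> {1..N} \<Longrightarrow> node N (k - 1) < node N k"
  by (auto simp: node_def divide_strict_right_mono)

lemma node_diff: "1 \<le> N \<Longrightarrow> k \<in> {1..N} \<Longrightarrow> node N k - node N (k - 1) = inverse (real N)"
  by (simp add: node_def field_simps of_nat_diff)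

lemma Kh_const: "(\<lambda>_. c :: 'a::real_normed_vector) \<in> Kh N"
  unfolding Kh_def
  by (intro CollectI conjI ballI, simp) (rule exI[of _ c], rule exI[of _ 0], simp)

lemma Kh_affine:
  fixes f :: "real \<Rightarrow> 'a::real_normed_vector"
  assumes "f \<in> Kh N" "k \<in> {1..N}"
  obtains a b where "\<And>\<rho>. \<rho> \<in> {node N (k - 1)..node N k} \<Longrightarrow> f \<rho> = a + \<rho> *\<^sub>R b"
  using assms unfolding Kh_def by blast

text \<open>On the open subinterval the function agrees with one affine map near each point, so the
  two-sided derivative exists and is its slope. The slope is the increment divided by the length
  \<open>1/N\<close> of the subinterval.\<close>

lemma Kh_vector_derivative:
  fixes f :: "real \<Rightarrow> 'a::real_normed_vector"
  assumes N: "1 \<le> N" and f: "f \<in> Kh N" and k: "k \<in> {1..N}"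
    and \<rho>: "\<rho> \<in> {node N (k - 1)<..<node N k}"
  shows "vector_derivative f (at \<rho>) = real N *\<^sub>R (f (node N k) - f (node N (k - 1)))"
proof -
  obtain a b where ab: "\<And>\<rho>. \<rho> \<in> {node N (k - 1)..node N k} \<Longrightarrow> f \<rho> = a + \<rho> *\<^sub>R b"
    using Kh_affine[OF f k] by blast
  have "((\<lambda>\<rho>. a + \<rho> *\<^sub>R b) has_vector_derivative b) (at \<rho>)"
    by (auto intro!: derivative_eq_intros)
  then have "(f has_vector_derivative b) (at \<rho>)"
    using \<rho> by (rule has_vector_derivative_transform_within_open[OF _ open_greaterThanLessThan])
      (simp add: ab)
  then have "vector_derivative f (at \<rho>) = b"
    by (rule vector_derivative_at)
  moreover have "f (node N k) - f (node N (k - 1)) = (node N k - node N (k - 1)) *\<^sub>R b"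
    using node_less[OF N k] by (simp add: ab scaleR_left_diff_distrib)
  ultimately show ?thesis
    using N by (simp only: node_diff[OF N k]) simp
qed

text \<open>The limits are one-sided because continuity is known only on [0,1], whose end points are
  themselves nodes.\<close>

lemma Kh_tendsto:
  fixes f :: "real \<Rightarrow> 'a::real_normed_vector"
  assumes N: "1 \<le> N" and f: "f \<in> Kh N" and k: "k \<in> {1..N}"
  shows "(f \<longlongrightarrow> f (node N k)) (at_left (node N k))"
    and "(f \<longlongrightarrow> f (node N (k - 1))) (at_right (node N (k - 1)))"
proof -
  have "{node N (k - 1)..node N k} \<subseteq> {0..1}"
    using N k by (auto simp: node_def field_simps intro: order_trans)
  then have "continuous_on {node N (k - 1)..node N k} f"
    using f by (auto simp: Kh_def intro: continuous_on_subset)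
  then show "(f \<longlongrightarrow> f (node N k)) (at_left (node N k))"
    "(f \<longlongrightarrow> f (node N (k - 1))) (at_right (node N (k - 1)))"
    using node_less[OF N k] continuous_on_Icc_at_leftD continuous_on_Icc_at_rightD by blast+
qed

text \<open>One-sided limits see only the open subintervals. The integrand may therefore be replaced
  on each of them by a formula \<open>g k\<close> of its own, whatever values it takes at the nodes,
  where derivatives may fail to exist.\<close>

lemma lumped_eqI:
  assumes N: "1 \<le> N"
    and eq: "\<And>k \<rho>. k \<in> {1..N} \<Longrightarrow> \<rho> \<in> {node N (k - 1)<..<node N k} \<Longrightarrow> u \<rho> \<bullet> v \<rho> = g k \<rho>"
    and l: "\<And>k. k \<in> {1..N} \<Longrightarrow> (g k \<longlongrightarrow> L k) (at_left (node N k))"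
    and r: "\<And>k. k \<in> {1..N} \<Longrightarrow> (g k \<longlongrightarrow> R k) (at_right (node N (k - 1)))"
  shows "lumped N Y u v = 1/2 * (\<Sum>k=1..N. norm (segment N Y k) * (L k + R k))"
proof -
  have "Lim (at_left (node N k)) (\<lambda>\<rho>. u \<rho> \<bullet> v \<rho>) = L k"
    and "Lim (at_right (node N (k - 1))) (\<lambda>\<rho>. u \<rho> \<bullet> v \<rho>) = R k" if k: "k \<in> {1..N}" for k
  proof -
    note less = node_less[OF N k]
    have "eventually (\<lambda>\<rho>. g k \<rho> = u \<rho> \<bullet> v \<rho>) (at_left (node N k))"
      using eventually_at_left_real[OF less] by eventually_elim (simp add: eq[OF k])
    then show "Lim (at_left (node N k)) (\<lambda>\<rho>. u \<rho> \<bullet> v \<rho>) = L k"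
      using l[OF k] by (intro tendsto_Lim) (auto intro: Lim_transform_eventually)
    have "eventually (\<lambda>\<rho>. g k \<rho> = u \<rho> \<bullet> v \<rho>) (at_right (node N (k - 1)))"
      using eventually_at_right_real[OF less] by eventually_elim (simp add: eq[OF k])
    then show "Lim (at_right (node N (k - 1))) (\<lambda>\<rho>. u \<rho> \<bullet> v \<rho>) = R k"
      using r[OF k] by (intro tendsto_Lim) (auto intro: Lim_transform_eventually)
  qed
  then show ?thesis
    unfolding lumped_def by simp
qed

lemma lumped_zero: "1 \<le> N \<Longrightarrow> (\<And>\<rho>. v \<rho> = 0) \<Longrightarrow> lumped N Y u v = 0"
  by (subst lumped_eqI[where g = "\<lambda>_ _. 0" and L = "\<lambda>_. 0" and R = "\<lambda>_. 0"]) auto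

lemma arc_deriv_const: "arc_deriv Y (\<lambda>_. c) \<rho> = 0"
  by (simp add: arc_deriv_def)

lemma perp_nth: "perp v $ 1 = v $ 2" "perp v $ 2 = - v $ 1"
  by (simp_all add: perp_def)

lemma perp_scaleR: "perp (c *\<^sub>R v) = c *\<^sub>R perp v"
  by (simp add: vec_eq_iff forall_2 perp_nth)

text \<open>Both derivatives carry the same factor \<open>N\<close>, which cancels between numerator
  and norm, so the half-step normal is constant on each subinterval.\<close>

lemma half_normal_eq:
  assumes N: "1 \<le> N" and Y: "Y \<in> Kh N" "Y' \<in> Kh N" and k: "k \<in> {1..N}"
    and \<rho>: "\<rho> \<in> {node N (k - 1)<..<node N k}"
  shows "half_normal Y Y' \<rho> =
    - (perp (segment N Y k + segment N Y' k) /\<^sub>R (2 * norm (segment N Y k)))"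
proof -
  have "vector_derivative Z (at \<rho>) = real N *\<^sub>R segment N Z k" if "Z \<in> Kh N" for Z
    using Kh_vector_derivative[OF N that k \<rho>] by (simp add: segment_def)
  then show ?thesis
    using N Y by (simp add: half_normal_def perp_scaleR flip: scaleR_right_distrib)
qed

text \<open>The quadrature weight \<open>norm (segment N Y k)\<close> cancels the same length in the
  denominator of the normal. The factor 1/4 is the 1/2 of the lumping times the 1/2 of the averaged
  normal.\<close>

lemma lumped_displacement:
  assumes N: "1 \<le> N" and Y: "Y \<in> Kh N" "Y' \<in> Kh N"
    and seg: "\<And>k. k \<in> {1..N} \<Longrightarrow> segment N Y k \<noteq> 0"
  shows "lumped N Y (\<lambda>\<rho>. ((Y' \<rho> - Y \<rho>) /\<^sub>R \<tau>) \<bullet> half_normal Y Y' \<rho>) (\<lambda>_. c) =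
    - (c / (4 * \<tau>) * (\<Sum>k=1..N. (Y' (node N k) - Y (node N k) + (Y' (node N (k - 1)) - Y (node N (k - 1))))
        \<bullet> perp (segment N Y k + segment N Y' k)))"
proof -
  define n where "n k = - (perp (segment N Y k + segment N Y' k) /\<^sub>R (2 * norm (segment N Y k)))" for k
  \<comment> \<open>\<open>p k i\<close> is the limit of the integrand at node \<open>i\<close>
    taken from inside subinterval \<open>k\<close>; an interior node has two such values, since the
    normal jumps there.\<close>
  define p where "p k i = (((Y' (node N i) - Y (node N i)) /\<^sub>R \<tau>) \<bullet> n k) \<bullet> c" for k i
  have "lumped N Y (\<lambda>\<rho>. ((Y' \<rho> - Y \<rho>) /\<^sub>R \<tau>) \<bullet> half_normal Y Y' \<rho>) (\<lambda>_. c) =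
    1/2 * (\<Sum>k=1..N. norm (segment N Y k) * (p k k + p k (k - 1)))"
    unfolding p_def
  proof (rule lumped_eqI[OF N, where g = "\<lambda>k \<rho>. (((Y' \<rho> - Y \<rho>) /\<^sub>R \<tau>) \<bullet> n k) \<bullet> c"])
    fix k \<rho> assume "k \<in> {1..N}" "\<rho> \<in> {node N (k - 1)<..<node N k}"
    then show "(((Y' \<rho> - Y \<rho>) /\<^sub>R \<tau>) \<bullet> half_normal Y Y' \<rho>) \<bullet> c = (((Y' \<rho> - Y \<rho>) /\<^sub>R \<tau>) \<bullet> n k) \<bullet> c"
      by (simp add: half_normal_eq[OF N Y] n_def)
  qed (intro tendsto_intros Kh_tendsto[OF N] Y; assumption)+
  also have "\<dots> = 1/2 * (\<Sum>k=1..N. - (c / (2 * \<tau>)) *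
     ((Y' (node N k) - Y (node N k) + (Y' (node N (k - 1)) - Y (node N (k - 1))))
        \<bullet> perp (segment N Y k + segment N Y' k)))"
  proof (rule arg_cong[where f = "(*) (1/2)"], rule sum.cong[OF refl])
    fix k assume "k \<in> {1..N}"
    then have h: "norm (segment N Y k) \<noteq> 0"
      using seg by simp
    have "norm (segment N Y k) * p k i = - (c / (2 * \<tau>)) *
      ((Y' (node N i) - Y (node N i)) \<bullet> perp (segment N Y k + segment N Y' k))" for i
      using h
      unfolding p_def n_def inner_scaleR_left inner_scaleR_right inner_minus_right inner_real_def
      \<comment> \<open>For \<open>\<tau> = 0\<close> both sides are 0, by the convention for
        division by zero.\<close>
      by (cases "\<tau> = 0") (simp_all add: divide_simps del: norm_eq_zero)
    then show "norm (segment N Y k) * (p k k + p k (k - 1)) = - (c / (2 * \<tau>)) *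
      ((Y' (node N k) - Y (node N k) + (Y' (node N (k - 1)) - Y (node N (k - 1))))
        \<bullet> perp (segment N Y k + segment N Y' k))"
      by (simp only: distrib_left inner_add_left)
  qed
  finally show ?thesis
    unfolding sum_distrib_left[symmetric] by simp
qed

text \<open>Edge \<open>k\<close> moves from its old to its new position across a quadrilateral
  whose signed area is half the cross product of its diagonals \<open>p\<close>, \<open>q\<close>.
  The two vectors in the inner product are \<open>p + q\<close> and \<open>p - q\<close>, so -1/4 of
  it is exactly that area. The other two sides of the quadrilateral contribute the boundary
  terms.\<close>

lemma area_below_diff:
  assumes N: "1 \<le> N"
  shows "area_below N Y' - area_below N Y =
    - (1/4 * (\<Sum>k=1..N. (Y' (node N k) - Y (node N k) + (Y' (node N (k - 1)) - Y (node N (k - 1))))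
        \<bullet> perp (segment N Y k + segment N Y' k)))
    + 1/2 * ((Y' 1 $ 1 - Y 1 $ 1) * (Y' 1 $ 2 + Y 1 $ 2)
           - (Y' 0 $ 1 - Y 0 $ 1) * (Y' 0 $ 2 + Y 0 $ 2))"
proof -
  \<comment> \<open>\<open>B k\<close> is the signed area below the straight path of node
    \<open>k\<close> from its old to its new position; neighbouring edges share it, so it
    telescopes.\<close>
  define B where "B k = 1/2 * ((Y' (node N k) $ 1 - Y (node N k) $ 1) *
    (Y' (node N k) $ 2 + Y (node N k) $ 2))" for k
  have "area_below N Y' - area_below N Y = (\<Sum>k=1..N. - (1/4 *
      ((Y' (node N k) - Y (node N k) + (Y' (node N (k - 1)) - Y (node N (k - 1))))
        \<bullet> perp (segment N Y k + segment N Y' k))) + (B k - B (k - 1)))"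
    unfolding area_below_def sum_distrib_left sum_subtractf[symmetric]
    by (intro sum.cong refl)
      (simp add: B_def inner_vec_def sum_2 perp_nth segment_def field_simps)
  also have "\<dots> = - (1/4 * (\<Sum>k=1..N. (Y' (node N k) - Y (node N k) + (Y' (node N (k - 1)) - Y (node N (k - 1))))
        \<bullet> perp (segment N Y k + segment N Y' k))) + (\<Sum>k=1..N. B k - B (k - 1))"
    by (simp add: sum.distrib sum_negf sum_distrib_left sum_subtractf)
  also have "(\<Sum>k=1..N. B k - B (k - 1)) = B N - B 0"
    using sum_telescope''[of 0 N B] N by (simp add: atLeastSucAtMost_greaterThanAtMost[symmetric])
  also have "\<dots> = 1/2 * ((Y' 1 $ 1 - Y 1 $ 1) * (Y' 1 $ 2 + Y 1 $ 2)
           - (Y' 0 $ 1 - Y 0 $ 1) * (Y' 0 $ 2 + Y 0 $ 2))"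
    using N by (simp add: B_def node_def algebra_simps)
  finally show ?thesis .
qed

text \<open>The contact point slides along the axis, so the boundary term at parameter 0 vanishes
  and only the junction term at parameter 1 is left.\<close>

lemma lumped_displacement_area:
  assumes N: "1 \<le> N" and Y: "Y \<in> Kh N" "Y' \<in> Kh N"
    and seg: "\<And>k. k \<in> {1..N} \<Longrightarrow> segment N Y k \<noteq> 0"
    and base: "Y 0 $ 2 = 0" "Y' 0 $ 2 = 0"
  shows "lumped N Y (\<lambda>\<rho>. ((Y' \<rho> - Y \<rho>) /\<^sub>R \<tau>) \<bullet> half_normal Y Y' \<rho>) (\<lambda>_. c) =
    c / \<tau> * (area_below N Y' - area_below N Y
      - 1/2 * ((Y' 1 $ 1 - Y 1 $ 1) * (Y' 1 $ 2 + Y 1 $ 2)))"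
  by (subst lumped_displacement[OF N Y seg], assumption)
    (simp add: area_below_diff[OF N] base)

theorem proposition4p1:
  fixes N :: "3 \<Rightarrow> nat"
    and t :: "nat \<Rightarrow> real"
    and \<gamma> K :: "3 \<Rightarrow> real^2 \<Rightarrow> real"
    and \<eta> :: "3 \<Rightarrow> real"
    and \<sigma>1 \<sigma>2 :: real
    and X :: "nat \<Rightarrow> 3 \<Rightarrow> real \<Rightarrow> real^2"
    and \<mu> :: "nat \<Rightarrow> 3 \<Rightarrow> real \<Rightarrow> real"
  assumes "\<And>j. N j \<ge> 1"
    and "t 0 = 0" and "\<And>m. t m < t (Suc m)"
    and "\<And>j. C2_on_circle (\<gamma> j)"
    and "\<And>j n. n \<in> sphere 0 1 \<Longrightarrow> \<gamma> j n > 0"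
    and "\<And>j n. n \<in> sphere 0 1 \<Longrightarrow> K j n \<ge> 0"
    and "\<And>j. \<eta> j > 0"
    and "X 0 \<in> Vh N"
    and "\<And>m. X (Suc m) \<in> Vh N" and "\<And>m. \<mu> (Suc m) \<in> Wh N"
    and "\<And>m j k. k \<in> {1..N j} \<Longrightarrow> segment (N j) (X m j) k \<noteq> 0"
    and "\<And>m \<phi>. \<phi> \<in> Wh N \<Longrightarrow>
      (\<Sum>j\<in>UNIV.
          lumped (N j) (X m j)
            (\<lambda>\<rho>. ((X (Suc m) j \<rho> - X m j \<rho>) /\<^sub>R (t (Suc m) - t m))
                   \<bullet> half_normal (X m j) (X (Suc m) j) \<rho>)
            (\<phi> j)
        + lumped (N j) (X m j) (arc_deriv (X m j) (\<mu> (Suc m) j)) (arc_deriv (X m j) (\<phi> j))) = 0"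
    and "\<And>m \<omega>. \<omega> \<in> Vh N \<Longrightarrow>
      (\<Sum>j\<in>UNIV.
          lumped (N j) (X m j)
            (\<lambda>\<rho>. \<mu> (Suc m) j \<rho> *\<^sub>R half_normal (X m j) (X (Suc m) j) \<rho>)
            (\<omega> j)
        - lumped (N j) (X m j)
            (\<lambda>\<rho>. Z_mat (\<gamma> j) (K j) (unit_normal (N j) (X m j) \<rho>)
                   *v arc_deriv (X m j) (X (Suc m) j) \<rho>)
            (arc_deriv (X m j) (\<omega> j)))
      - (1 / \<eta> 1 * ((X (Suc m) 1 0 $ 1 - X m 1 0 $ 1) / (t (Suc m) - t m)) + \<sigma>1) * \<omega> 1 0 $ 1
      - (1 / \<eta> 2 * ((X (Suc m) 2 0 $ 1 - X m 2 0 $ 1) / (t (Suc m) - t m)) - \<sigma>2) * \<omega> 2 0 $ 1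
      - (1 / \<eta> 3 * ((X (Suc m) 3 0 $ 1 - X m 3 0 $ 1) / (t (Suc m) - t m)) + \<sigma>2 - \<sigma>1) * \<omega> 3 0 $ 1
      = 0"
  shows "\<forall>m. total_area N (X m) = total_area N (X 0)"
proof
  note N = assms(1) and step = assms(3) and seg = assms(11) and scheme = assms(12)
  have X: "X m \<in> Vh N" for m
    using assms(8,9) by (cases m) auto
  then have Kh: "X m j \<in> Kh (N j)" and base: "X m j 0 $ 2 = 0" and junction: "X m 2 1 = X m 1 1" for m j
    by (auto simp: Vh_def)
  have area_step: "total_area N (X (Suc m)) = total_area N (X m)" for m
  proof -
    define \<tau> where "\<tau> = t (Suc m) - t m"
    \<comment> \<open>The signs are those of curves 1 and 2 in \<open>total_area\<close>.\<close>
    define c :: "3 \<Rightarrow> real" where "c j = (if j = 1 then -1 else if j = 2 then 1 else 0)" for j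
    have c: "c 1 = -1" "c 2 = 1" "c 3 = 0"
      by (simp_all add: c_def)
    have "(\<lambda>j _. c j) \<in> Wh N"
      by (simp add: Wh_def Kh_const sum_3 c)
    from scheme[OF this, of m] have "(\<Sum>j\<in>UNIV. c j / \<tau> *
        (area_below (N j) (X (Suc m) j) - area_below (N j) (X m j)
          - 1/2 * ((X (Suc m) j 1 $ 1 - X m j 1 $ 1) * (X (Suc m) j 1 $ 2 + X m j 1 $ 2)))) = 0"
      by (simp only: \<tau>_def lumped_displacement_area[OF N Kh Kh seg base base]
          lumped_zero[OF N arc_deriv_const] add_0_right)
    moreover have "\<tau> > 0"
      using step[of m] by (simp add: \<tau>_def)
    \<comment> \<open>By \<open>junction\<close> the end-point terms of curves 1 and 2 are equal and
      enter with opposite signs. What remains is the change of \<open>total_area\<close> divided by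
      \<open>\<tau>\<close>, and \<open>\<tau>\<close> is nonzero.\<close>
    ultimately show ?thesis
      by (simp add: sum_3 c junction total_area_def flip: right_diff_distrib add_divide_distrib diff_divide_distrib)
  qed
  show "total_area N (X m) = total_area N (X 0)" for m
    by (induction m) (simp_all add: area_step)
qed

end
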